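(* Fix $m\ge 1$, a weight vector $W\in\mathbb{R}^{n_b}$, an original injected power vector $P^0\in\mathbb{R}^{n_b}$, bounds $\underline{P}_i\le\bar{P}_i$, thresholds $\sigma_{ij}>0$ for $(i,j)\in\mathcal{E}$, and the admittance vector $Y_p^m$ produced by the cascade before any load shedding (see context). The optimization problem in the variable $P=(P_1,\dots,P_{n_b})^T\in\mathbb{R}^{n_b}$ $$\min_{P}\ \|W\circ(P-P^0)\|^2\quad\text{s.t.}\quad (P^m_{ij})^2\le\sigma_{ij}^2\ \ \forall (i,j)\in\mathcal{E},\qquad \underline{P}_i\le P_i\le\bar{P}_i\ \ \forall i\in\{1,\dots,n_b\},$$ where $$P^m_{ij}=e_i^TA^T\mathrm{diag}(Y^m_p)Ae_j\,(e_i-e_j)^T(A^T\mathrm{diag}(Y^m_p)A)^{-1^*}P ,$$ is a convex optimization problem, i.e. the objective is a convex function of $P$ and every constraint has the form $h(P)\le 0$ with $h$ convex.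
   Context: A power network has $n_b$ buses and $n$ branches, with branch-bus incidence matrix $A\in\mathbb{R}^{n\times n_b}$; branch $l$ connects buses $i_l$ and $j_l$. $\mathcal{E}$ is the set of pairs $(i,j)$ of connected buses. $e_i\in\mathbb{R}^{n_b}$ is the $i$-th standard unit vector, $\mathrm{diag}(x)$ is the diagonal matrix with diagonal $x$, $\circ$ is the Hadamard (entrywise) product, $\|\cdot\|$ is the Euclidean norm. $M\mapsto M^{-1^*}$ is a fixed operator assigning to each (possibly singular) matrix $M\in\mathbb{R}^{n_b\times n_b}$ a (generalized inverse) matrix in $\mathbb{R}^{n_b\times n_b}$. Cascade. $Y_p^1=Y_p^0+\delta\in\mathbb{R}^n$ is the given branch admittance vector after the initial disturbance $\delta$. For $k=1,\dots,m-1$, $Y_p^{k+1}=\mathcal{G}(P^k_{ij})\circ Y_p^k$, where $\mathcal{G}(P^k_{ij})=(g(P^k_{i_1j_1},c_{i_1j_1}),\dots,g(P^k_{i_nj_n},c_{i_nj_n}))^T$ and, before load shedding, $P^k_{ij}=e_i^TA^T\mathrm{diag}(Y^k_p)Ae_j(e_i-e_j)^T(A^T\mathrm{diag}(Y^k_p)A)^{-1^*}P^0$ for $k\le m-1$. Here $c_{ij}$ is the line's power threshold, $\sigma>0$ is a parameter, and $g(p,c)=0$ if $|p|\ge\sqrt{c^2+\pi/(2\sigma)}$, $g(p,c)=1$ if $|p|\le\sqrt{c^2-\pi/(2\sigma)}$, and $g(p,c)=\frac12\left(1-\sin(\sigma[p^2-c^2])\right)$ otherwise. Thus $Y_p^m$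 does not depend on the decision variable $P$. *)

theory Defs
  imports "HOL-Analysis.Analysis"
begin

text \<open>
  Buses are the elements of a finite type \<open>'b\<close>, branches those of a finite type \<open>'l\<close>; branch \<open>l\<close>
  connects the buses \<open>src l\<close> and \<open>dst l\<close>.  The standard unit vector at bus \<open>i\<close> is \<open>axis i 1\<close>, and the
  Hadamard product is the library multiplication \<open>*\<close> of the type \<open>real ^ 'n\<close>.
\<close>

definition incidence_matrix :: "('l::finite \<Rightarrow> 'b::finite) \<Rightarrow> ('l \<Rightarrow> 'b) \<Rightarrow> real ^ 'b ^ 'l" where
  "incidence_matrix src dst =
     (\<chi> l b. (if b = src l then 1 else 0) - (if b = dst l then 1 else 0))"

text \<open>Both orientations of every branch are included.\<close>

definition connected_pairs :: "('l::finite \<Rightarrow> 'b::finite) \<Rightarrow> ('l \<Rightarrow> 'b) \<Rightarrow> ('b \<times> 'b) set" where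
  "connected_pairs src dst = {(i, j). \<exists>l. (src l = i \<and> dst l = j) \<or> (src l = j \<and> dst l = i)}"

definition diag_matrix :: "real ^ 'n \<Rightarrow> real ^ 'n ^ 'n" where
  "diag_matrix x = (\<chi> i j. if i = j then x $ i else 0)"

definition nodal_matrix :: "real ^ 'b ^ 'l \<Rightarrow> real ^ 'l \<Rightarrow> real ^ 'b ^ 'b" where
  "nodal_matrix A Y = transpose A ** diag_matrix Y ** A"

text \<open>The argument \<open>ginv\<close> is the operator \<open>M \<mapsto> M\<^sup>-\<^sup>1\<^sup>*\<close>.\<close>

definition power_flow ::
  "real ^ 'b ^ 'l \<Rightarrow> (real ^ 'b ^ 'b \<Rightarrow> real ^ 'b ^ 'b) \<Rightarrow> real ^ 'l \<Rightarrow> real ^ 'b \<Rightarrow> 'b \<Rightarrow> 'b \<Rightarrow> real" where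
  "power_flow A ginv Y P i j =
     (axis i 1 \<bullet> (nodal_matrix A Y *v axis j 1)) *
     ((axis i 1 - axis j 1) \<bullet> (ginv (nodal_matrix A Y) *v P))"

text \<open>
  If \<open>c\<^sup>2 < pi / (2 * \<sigma>)\<close>, the library's odd extension makes the second root negative, so that the
  second case never applies.
\<close>

definition trip_factor :: "real \<Rightarrow> real \<Rightarrow> real \<Rightarrow> real" where
  "trip_factor \<sigma> p c =
     (if \<bar>p\<bar> \<ge> sqrt (c\<^sup>2 + pi / (2 * \<sigma>)) then 0
      else if \<bar>p\<bar> \<le> sqrt (c\<^sup>2 - pi / (2 * \<sigma>)) then 1
      else 1 / 2 * (1 - sin (\<sigma> * (p\<^sup>2 - c\<^sup>2))))"

definition trip_vector ::
  "real \<Rightarrow> ('b \<Rightarrow> 'b \<Rightarrow> real) \<Rightarrow> ('l::finite \<Rightarrow> 'b) \<Rightarrow> ('l \<Rightarrow> 'b) \<Rightarrow> ('b \<Rightarrow> 'b \<Rightarrow> real) \<Rightarrow> real ^ 'l" where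
  "trip_vector \<sigma> c src dst F =
     (\<chi> l. trip_factor \<sigma> (F (src l) (dst l)) (c (src l) (dst l)))"

text \<open>
  The value at \<open>k\<close> is the admittance vector at cascading step \<open>k\<close>; step \<open>0\<close> is the state before the
  initial disturbance \<open>\<delta>\<close>.
\<close>

fun cascade ::
  "('l::finite \<Rightarrow> 'b::finite) \<Rightarrow> ('l \<Rightarrow> 'b) \<Rightarrow> (real ^ 'b ^ 'b \<Rightarrow> real ^ 'b ^ 'b) \<Rightarrow> real \<Rightarrow>
   ('b \<Rightarrow> 'b \<Rightarrow> real) \<Rightarrow> real ^ 'b \<Rightarrow> real ^ 'l \<Rightarrow> real ^ 'l \<Rightarrow> nat \<Rightarrow> real ^ 'l" where
  "cascade src dst ginv \<sigma> c P0 Y0 \<delta> 0 = Y0"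
| "cascade src dst ginv \<sigma> c P0 Y0 \<delta> (Suc 0) = Y0 + \<delta>"
| "cascade src dst ginv \<sigma> c P0 Y0 \<delta> (Suc (Suc k)) =
     (let Y = cascade src dst ginv \<sigma> c P0 Y0 \<delta> (Suc k)
      in trip_vector \<sigma> c src dst (power_flow (incidence_matrix src dst) ginv Y P0) * Y)"

text \<open>
  A minimization problem over the whole space.  A pair \<open>(f, g)\<close> in \<open>constraints\<close> stands for the
  constraint \<open>f x \<le> g x\<close>, which has the standard form \<open>h x \<le> 0\<close> with \<open>h = (\<lambda>x. f x - g x)\<close>.
\<close>

record 'x min_problem =
  objective :: "'x \<Rightarrow> real"
  constraints :: "(('x \<Rightarrow> real) \<times> ('x \<Rightarrow> real)) set"

definition convex_problem :: "'x::real_vector min_problem \<Rightarrow> bool" where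
  "convex_problem Q \<longleftrightarrow>
     convex_on UNIV (objective Q) \<and>
     (\<forall>(f, g) \<in> constraints Q. convex_on UNIV (\<lambda>x. f x - g x))"

end

theory Submission
  imports Defs
begin

text \<open>
  The cascade runs under the original injection \<open>P0\<close> alone, so the admittances at step \<open>m\<close> are
  constants of the optimization problem.  With the nodal matrix fixed, its generalized inverse is one
  fixed matrix as well, so every line flow is a linear functional of \<open>P\<close>.
  The weighting \<open>P \<mapsto> W * P\<close> is linear too.  Hence the objective and the left-hand
  sides of the flow constraints are all squared norms of affine maps, which are convex because the
  norm is convex and squaring preserves convexity of nonnegative functions
  (\<open>convex_on_norm_affine_power2\<close>); subtracting a constant threshold changes nothing.  The box
  constraints are affine.
\<close>

text \<open>
  Nonnegativity makes squaring monotone on the values of \<open>f\<close>, so the convexity inequality survives it.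
\<close>

lemma convex_on_nonneg_power2:
  fixes f :: "'a::real_vector \<Rightarrow> real"
  assumes f: "convex_on S f" and nonneg: "\<And>x. x \<in> S \<Longrightarrow> 0 \<le> f x"
  shows "convex_on S (\<lambda>x. (f x)\<^sup>2)"
proof (rule convex_onI)
  fix t :: real and x y
  assume t: "0 < t" "t < 1" and xy: "x \<in> S" "y \<in> S"
  let ?z = "(1 - t) *\<^sub>R x + t *\<^sub>R y"
  have "?z \<in> S"
    using convexD[OF convex_on_imp_convex[OF f] xy, of "1 - t" t] t by simp
  then have "(f ?z)\<^sup>2 \<le> ((1 - t) * f x + t * f y)\<^sup>2"
    using convex_onD[OF f, of t x y] t xy nonneg by (intro power_mono) auto
  also have "\<dots> \<le> (1 - t) * (f x)\<^sup>2 + t * (f y)\<^sup>2"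
    using convex_onD[OF convex_power2, of t "f x" "f y"] t by simp
  finally show "(f ?z)\<^sup>2 \<le> (1 - t) * (f x)\<^sup>2 + t * (f y)\<^sup>2" .
qed (rule convex_on_imp_convex[OF f])

lemma convex_on_norm_affine:
  fixes f :: "'a::real_vector \<Rightarrow> 'b::real_normed_vector"
  assumes "linear f"
  shows "convex_on UNIV (\<lambda>x. norm (f x - b))"
proof (rule convex_onI)
  fix t :: real and x y
  assume t: "0 < t" "t < 1"
  have "f ((1 - t) *\<^sub>R x + t *\<^sub>R y) - b = (1 - t) *\<^sub>R (f x - b) + t *\<^sub>R (f y - b)"
    unfolding linear_add[OF assms] linear_cmul[OF assms] by (simp add: algebra_simps)
  then show "norm (f ((1 - t) *\<^sub>R x + t *\<^sub>R y) - b) \<le> (1 - t) * norm (f x - b) + t * norm (f y - b)"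
    using norm_triangle_ineq[of "(1 - t) *\<^sub>R (f x - b)" "t *\<^sub>R (f y - b)"] t by simp
qed simp

lemma convex_on_norm_affine_power2:
  fixes f :: "'a::real_vector \<Rightarrow> 'b::real_normed_vector"
  assumes "linear f"
  shows "convex_on UNIV (\<lambda>x. (norm (f x - b))\<^sup>2)"
  by (intro convex_on_nonneg_power2 convex_on_norm_affine assms norm_ge_zero)

text \<open>
  The injection enters the flow formula only through a matrix-vector product; the admittances
  are a separate argument, which is where it matters that they do not depend on \<open>P\<close>.
\<close>

lemma linear_power_flow: "linear (\<lambda>P. power_flow A ginv Y P i j)"
  unfolding power_flow_def
  by (intro linearI)
    (simp_all add: matrix_vector_right_distrib matrix_vector_mult_scaleR inner_add_right algebra_simps)

lemma convex_on_affine_component: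
  fixes a b :: real
  shows "convex_on UNIV (\<lambda>P :: real ^ 'n. a * P $ i + b)"
  by (rule convex_onI) (auto simp: algebra_simps)

theorem proposition3p1:
  fixes src dst :: "'l::finite \<Rightarrow> 'b::finite"
    and ginv :: "real ^ 'b ^ 'b \<Rightarrow> real ^ 'b ^ 'b"
    and \<sigma> :: real
    and c :: "'b \<Rightarrow> 'b \<Rightarrow> real"
    and Y0 \<delta> :: "real ^ 'l"
    and W P0 Pmin Pmax :: "real ^ 'b"
    and threshold :: "'b \<Rightarrow> 'b \<Rightarrow> real"
    and m :: nat
  assumes "\<And>l. src l \<noteq> dst l"
    and "\<sigma> > 0"
    and "m \<ge> 1"
    and "\<And>i. Pmin $ i \<le> Pmax $ i"
    and "\<And>i j. (i, j) \<in> connected_pairs src dst \<Longrightarrow> threshold i j > 0"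
  defines "Ym \<equiv> cascade src dst ginv \<sigma> c P0 Y0 \<delta> m"
  defines "flow \<equiv> power_flow (incidence_matrix src dst) ginv Ym"
  shows "convex_problem
    \<lparr>objective = (\<lambda>P :: real ^ 'b. (norm (W * (P - P0)))\<^sup>2),
     constraints =
       {(\<lambda>P. (flow P i j)\<^sup>2, \<lambda>P. (threshold i j)\<^sup>2) | i j. (i, j) \<in> connected_pairs src dst}
       \<union> {(\<lambda>P. Pmin $ i, \<lambda>P. P $ i) | i. True}
       \<union> {(\<lambda>P. P $ i, \<lambda>P. Pmax $ i) | i. True}\<rparr>"
proof -
  have objective: "convex_on UNIV (\<lambda>P :: real ^ 'b. (norm (W * (P - P0)))\<^sup>2)"
  proof -
    have "linear (\<lambda>P :: real ^ 'b. W * P)"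
      by (intro linearI) (simp_all add: vec_eq_iff algebra_simps)
    from convex_on_norm_affine_power2[OF this, of "W * P0"] show ?thesis
      by (simp add: right_diff_distrib)
  qed
  have flow_constraint: "convex_on UNIV (\<lambda>P. (flow P i j)\<^sup>2 - (threshold i j)\<^sup>2)" for i j
  proof -
    have "convex_on UNIV (\<lambda>P. (flow P i j)\<^sup>2)"
      using convex_on_norm_affine_power2[OF linear_power_flow, where b = 0]
      unfolding flow_def by simp
    from convex_on_add[OF this, of "\<lambda>_. - (threshold i j)\<^sup>2"] show ?thesis
      by (simp add: convex_on_const)
  qed
  have lower_bound: "convex_on UNIV (\<lambda>P :: real ^ 'b. Pmin $ i - P $ i)" for i
    using convex_on_affine_component[of "- 1" i "Pmin $ i"] by simp
  have upper_bound: "convex_on UNIV (\<lambda>P :: real ^ 'b. P $ i - Pmax $ i)" for i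
    using convex_on_affine_component[of 1 i "- Pmax $ i"] by simp
  show ?thesis
    unfolding convex_problem_def
    using objective flow_constraint lower_bound upper_bound by auto
qed

end
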